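(* Let $E$ be a finite directed graph with talented monoid $T_E$, regarded as a $\mathbb Z$-monoid. There is a one-to-one correspondence between the sinks in $E$ and the non-comparable minimal $\mathbb Z$-order-ideals of $T_E$. Furthermore, the sum of all non-comparable minimal $\mathbb Z$-order-ideals is the largest non-comparable $\mathbb Z$-order-ideal of $T_E$.
   Context: A directed graph $E=(E^0,E^1,r,s)$ has vertex set $E^0$, edge set $E^1$ and range and source maps $r,s:E^1\to E^0$; it is finite if $E^0$ and $E^1$ are finite. A vertex $v$ is a sink if $s^{-1}(v)=\emptyset$. The talented monoid $T_E$ is the commutative monoid generated by $\{v(i)\mid v\in E^0,\ i\in\mathbb Z\}$ subject to $v(i)=\sum_{e\in s^{-1}(v)}r(e)(i+1)$ for all $i\in\mathbb Z$ and all $v\in E^0$ that are not sinks. The group $\mathbb Z$ acts on it by ${}^nv(i)=v(i+n)$. On $T_E$ write $a\le b$ if $b=a+c$ for some $c\in T_E$, and $a\parallel b$ if neither $a\le b$ nor $b\le a$. A $\mathbb Z$-order-ideal of $T_E$ is a submonoid $I$ closed under the $\mathbb Z$-action such that $a+b\in I$ implies $a,b\in I$. It is non-comparable if ${}^nx\parallel x$ for every $0\neq x\in I$ and every $0\ne n\in\mathbb Z$. It is minimal if it is minimal among the non-zero $\mathbb Z$-order-ideals. *)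

theory Defs
  imports
    "Graph_Theory.Digraph"
    "HOL-Algebra.FiniteProduct"
    "HOL-Library.Multiset"
begin

section \<open>The talented monoid\<close>

definition sinks :: "('a, 'b) pre_digraph \<Rightarrow> 'a set" where
  "sinks G = {v \<in> verts G. out_arcs G v = {}}"

text \<open>
  The free commutative monoid on the symbols \<open>v(i)\<close> is realised as the set of finite multisets
  of pairs \<open>(v, i)\<close>.
\<close>

definition words :: "('a, 'b) pre_digraph \<Rightarrow> ('a \<times> int) multiset set" where
  "words G = {w. set_mset w \<subseteq> verts G \<times> UNIV}"

text \<open>
  The least congruence containing the defining relations. In \<open>step\<close> the right-hand side ranges over
  edges, not over their ranges, so that parallel edges contribute repeatedly. It is the intended sum
  only when \<^term>\<open>out_arcs G v\<close> is finite.
\<close>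

inductive talented_eq ::
    "('a, 'b) pre_digraph \<Rightarrow> ('a \<times> int) multiset \<Rightarrow> ('a \<times> int) multiset \<Rightarrow> bool"
  for G where
  step: "\<lbrakk>v \<in> verts G; out_arcs G v \<noteq> {}\<rbrakk>
    \<Longrightarrow> talented_eq G {#(v, i)#} (image_mset (\<lambda>e. (head G e, i + 1)) (mset_set (out_arcs G v)))"
| refl: "w \<in> words G \<Longrightarrow> talented_eq G w w"
| sym: "talented_eq G w w' \<Longrightarrow> talented_eq G w' w"
| trans: "\<lbrakk>talented_eq G w w'; talented_eq G w' w''\<rbrakk> \<Longrightarrow> talented_eq G w w''"
| add: "\<lbrakk>talented_eq G w w'; talented_eq G u u'\<rbrakk> \<Longrightarrow> talented_eq G (w + u) (w' + u')"

definition talented_rel :: "('a, 'b) pre_digraph \<Rightarrow> ('a \<times> int) multiset rel" where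
  "talented_rel G = {(w, w'). talented_eq G w w'}"

definition talented_monoid :: "('a, 'b) pre_digraph \<Rightarrow> ('a \<times> int) multiset set monoid" where
  "talented_monoid G =
    \<lparr>carrier = words G // talented_rel G,
     monoid.mult = (\<lambda>x y. \<Union>w\<in>x. \<Union>u\<in>y. talented_rel G `` {w + u}),
     one = talented_rel G `` {{#}}\<rparr>"

definition shift_word :: "int \<Rightarrow> ('a \<times> int) multiset \<Rightarrow> ('a \<times> int) multiset" where
  "shift_word n = image_mset (\<lambda>(v, i). (v, i + n))"

definition shift :: "('a, 'b) pre_digraph \<Rightarrow> int
    \<Rightarrow> ('a \<times> int) multiset set \<Rightarrow> ('a \<times> int) multiset set" where
  "shift G n x = (\<Union>w\<in>x. talented_rel G `` {shift_word n w})"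


section \<open>Order ideals of commutative monoids with an action of the integers\<close>

text \<open>Monoids are written multiplicatively, as \<open>\<otimes>\<close> and \<open>\<one>\<close>; these are the \<open>+\<close> and \<open>0\<close> of \<open>T\<^sub>E\<close>.\<close>

definition alg_le :: "('m, 'c) monoid_scheme \<Rightarrow> 'm \<Rightarrow> 'm \<Rightarrow> bool" where
  "alg_le M a b \<longleftrightarrow> (\<exists>c \<in> carrier M. b = a \<otimes>\<^bsub>M\<^esub> c)"

definition incomparable :: "('m, 'c) monoid_scheme \<Rightarrow> 'm \<Rightarrow> 'm \<Rightarrow> bool" where
  "incomparable M a b \<longleftrightarrow> \<not> alg_le M a b \<and> \<not> alg_le M b a"

definition Z_order_ideal :: "('m, 'c) monoid_scheme \<Rightarrow> (int \<Rightarrow> 'm \<Rightarrow> 'm) \<Rightarrow> 'm set \<Rightarrow> bool" where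
  "Z_order_ideal M act I \<longleftrightarrow>
     submonoid I M \<and>
     (\<forall>n. \<forall>x \<in> I. act n x \<in> I) \<and>
     (\<forall>a \<in> carrier M. \<forall>b \<in> carrier M. a \<otimes>\<^bsub>M\<^esub> b \<in> I \<longrightarrow> a \<in> I \<and> b \<in> I)"

definition non_comparable :: "('m, 'c) monoid_scheme \<Rightarrow> (int \<Rightarrow> 'm \<Rightarrow> 'm) \<Rightarrow> 'm set \<Rightarrow> bool" where
  "non_comparable M act I \<longleftrightarrow>
     (\<forall>x \<in> I. x \<noteq> \<one>\<^bsub>M\<^esub> \<longrightarrow> (\<forall>n. n \<noteq> 0 \<longrightarrow> incomparable M (act n x) x))"

definition minimal_Z_order_ideal ::
    "('m, 'c) monoid_scheme \<Rightarrow> (int \<Rightarrow> 'm \<Rightarrow> 'm) \<Rightarrow> 'm set \<Rightarrow> bool" where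
  "minimal_Z_order_ideal M act I \<longleftrightarrow>
     Z_order_ideal M act I \<and> I \<noteq> {\<one>\<^bsub>M\<^esub>} \<and>
     (\<forall>J. Z_order_ideal M act J \<and> J \<noteq> {\<one>\<^bsub>M\<^esub>} \<and> J \<subseteq> I \<longrightarrow> J = I)"

definition non_comparable_minimal_ideals ::
    "('m, 'c) monoid_scheme \<Rightarrow> (int \<Rightarrow> 'm \<Rightarrow> 'm) \<Rightarrow> 'm set set" where
  "non_comparable_minimal_ideals M act =
     {I. minimal_Z_order_ideal M act I \<and> non_comparable M act I}"

text \<open>
  The sum of a family of submonoids: all sums of finitely many elements taken from distinct members.
  The sum of the empty family is the zero ideal.
\<close>

definition ideal_sum :: "('m, 'c) monoid_scheme \<Rightarrow> 'm set set \<Rightarrow> 'm set" where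
  "ideal_sum M \<I> = {finprod M x F | x F. finite F \<and> F \<subseteq> \<I> \<and> (\<forall>I \<in> F. x I \<in> I)}"

definition largest_non_comparable_ideal ::
    "('m, 'c) monoid_scheme \<Rightarrow> (int \<Rightarrow> 'm \<Rightarrow> 'm) \<Rightarrow> 'm set \<Rightarrow> bool" where
  "largest_non_comparable_ideal M act I \<longleftrightarrow>
     Z_order_ideal M act I \<and> non_comparable M act I \<and>
     (\<forall>J. Z_order_ideal M act J \<and> non_comparable M act J \<longrightarrow> J \<subseteq> I)"


section \<open>Well-definedness\<close>

lemma words_add: "w \<in> words G \<Longrightarrow> u \<in> words G \<Longrightarrow> w + u \<in> words G"
  by (auto simp: words_def)

lemma shift_word_words: "w \<in> words G \<Longrightarrow> shift_word n w \<in> words G"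
  by (auto simp: words_def shift_word_def)

lemma shift_word_add: "shift_word n (w + u) = shift_word n w + shift_word n u"
  by (simp add: shift_word_def)

lemma shift_word_shift_word: "shift_word m (shift_word n w) = shift_word (m + n) w"
  by (simp add: shift_word_def image_mset.compositionality o_def case_prod_unfold algebra_simps)

lemma shift_word_0: "shift_word 0 w = w"
  by (simp add: shift_word_def)

context fin_digraph
begin

lemma talented_eq_words: "talented_eq G w w' \<Longrightarrow> w \<in> words G \<and> w' \<in> words G"
proof (induction rule: talented_eq.induct)
  case (step v i)
  then show ?case by (auto simp: words_def out_arcs_def)
qed (auto simp: words_def)

lemma equiv_talented_rel: "equiv (words G) (talented_rel G)"
  unfolding talented_rel_def
  by (rule equivI)
     (auto simp: refl_on_def intro!: symI transI
       intro: talented_eq.refl talented_eq.sym talented_eq.trans dest: talented_eq_words)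

lemma talented_eq_shift_word:
  "talented_eq G w w' \<Longrightarrow> talented_eq G (shift_word n w) (shift_word n w')"
proof (induction rule: talented_eq.induct)
  case (step v i)
  then show ?case
    using talented_eq.step[of v G "i + n"]
    by (simp add: shift_word_def image_mset.compositionality o_def algebra_simps)
qed (auto simp: shift_word_add intro: talented_eq.intros shift_word_words)

lemma talented_mult_class:
  assumes "w \<in> words G" "u \<in> words G"
  shows "talented_rel G `` {w} \<otimes>\<^bsub>talented_monoid G\<^esub> talented_rel G `` {u}
    = talented_rel G `` {w + u}"
proof -
  have "congruent2 (talented_rel G) (talented_rel G) (\<lambda>w u. talented_rel G `` {w + u})"
    by (intro congruent2I' equiv_class_eq[OF equiv_talented_rel])
       (auto simp: talented_rel_def intro: talented_eq.add)
  from UN_equiv_class2[OF equiv_talented_rel equiv_talented_rel this assms]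
  show ?thesis by (simp add: talented_monoid_def)
qed

lemma shift_class:
  assumes "w \<in> words G"
  shows "shift G n (talented_rel G `` {w}) = talented_rel G `` {shift_word n w}"
proof -
  have "congruent (talented_rel G) (\<lambda>w. talented_rel G `` {shift_word n w})"
    by (intro congruentI equiv_class_eq[OF equiv_talented_rel])
       (auto simp: talented_rel_def intro: talented_eq_shift_word)
  from UN_equiv_class[OF equiv_talented_rel this assms]
  show ?thesis by (simp add: shift_def)
qed

lemma carrier_talented_monoid_cases:
  assumes "x \<in> carrier (talented_monoid G)"
  obtains w where "w \<in> words G" "x = talented_rel G `` {w}"
  using assms by (auto simp: talented_monoid_def elim: quotientE)

lemma class_in_carrier:
  "w \<in> words G \<Longrightarrow> talented_rel G `` {w} \<in> carrier (talented_monoid G)"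
  by (auto simp: talented_monoid_def intro: quotientI)

lemma one_talented_monoid: "\<one>\<^bsub>talented_monoid G\<^esub> = talented_rel G `` {{#}}"
  by (simp add: talented_monoid_def)

lemma empty_words: "{#} \<in> words G"
  by (simp add: words_def)

lemma comm_monoid_talented_monoid: "comm_monoid (talented_monoid G)"
  by (rule comm_monoidI)
     (auto elim!: carrier_talented_monoid_cases
       simp: one_talented_monoid talented_mult_class class_in_carrier words_add empty_words
         ac_simps)

lemma shift_in_carrier:
  "x \<in> carrier (talented_monoid G) \<Longrightarrow> shift G n x \<in> carrier (talented_monoid G)"
  by (auto elim!: carrier_talented_monoid_cases simp: shift_class class_in_carrier shift_word_words)

lemma shift_mult:
  assumes "x \<in> carrier (talented_monoid G)" "y \<in> carrier (talented_monoid G)"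
  shows "shift G n (x \<otimes>\<^bsub>talented_monoid G\<^esub> y)
    = shift G n x \<otimes>\<^bsub>talented_monoid G\<^esub> shift G n y"
  using assms
  by (auto elim!: carrier_talented_monoid_cases
      simp: shift_class talented_mult_class words_add shift_word_words shift_word_add)

lemma shift_zero: "x \<in> carrier (talented_monoid G) \<Longrightarrow> shift G 0 x = x"
  by (auto elim!: carrier_talented_monoid_cases simp: shift_class shift_word_0)

lemma shift_shift:
  "x \<in> carrier (talented_monoid G) \<Longrightarrow> shift G m (shift G n x) = shift G (m + n) x"
  by (auto elim!: carrier_talented_monoid_cases
      simp: shift_class shift_word_words shift_word_shift_word)

end

end

theory Submission
  imports Defs
begin

text \<open>
  Replacing every letter \<open>v(i)\<close> with \<open>v\<close> not a sink by the right-hand side of its defining relation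
  develops a word, and a word develops to at most one word in sinks. Which word in sinks this is, if
  any, is invariant under the congruence, so the classes of words in a set \<open>V\<close> of sinks form a free
  commutative monoid on \<open>V \<times> \<int>\<close>; it is an order ideal, and it is non-comparable because the shift
  preserves the length of a word. Conversely, let \<open>J\<close> be a non-comparable order ideal. A vertex in \<open>J\<close>
  that does not develop to sinks has a successor of the same kind, which yields a cycle in \<open>J\<close>; a
  vertex on a cycle dominates one of its own shifts, which is impossible. So \<open>J\<close> lies in the ideal of
  all sinks.
\<close>

section \<open>Words over a vertex set and their shifts\<close>

definition words_over :: "'a set \<Rightarrow> ('a \<times> int) multiset set" where
  "words_over V = {w. set_mset w \<subseteq> V \<times> UNIV}"

lemma words_over_mono: "V \<subseteq> W \<Longrightarrow> words_over V \<subseteq> words_over W"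
  by (auto simp: words_over_def)

lemma empty_words_over [simp]: "{#} \<in> words_over V"
  by (simp add: words_over_def)

lemma letter_words_over [simp]: "{#(v, i)#} \<in> words_over V \<longleftrightarrow> v \<in> V"
  by (simp add: words_over_def)

lemma add_words_over [simp]: "w + u \<in> words_over V \<longleftrightarrow> w \<in> words_over V \<and> u \<in> words_over V"
  by (auto simp: words_over_def)

lemma shift_word_words_over [simp]: "shift_word n w \<in> words_over V \<longleftrightarrow> w \<in> words_over V"
  by (auto simp: words_over_def shift_word_def)

lemma words_over_induct [consumes 1, case_names empty add]:
  assumes "w \<in> words_over V"
    and "P {#}"
    and "\<And>v i w. \<lbrakk>v \<in> V; w \<in> words_over V; P w\<rbrakk> \<Longrightarrow> P (add_mset (v, i) w)"
  shows "P w"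
  using assms(1)
proof (induction w)
  case empty
  show ?case by (rule assms(2))
next
  case (add p w)
  then show ?case
    using assms(3)[of "fst p" w "snd p"] by (auto simp: words_over_def)
qed

text \<open>Shifting by \<open>n\<close> changes the sum of the indices by \<open>n\<close> times
  the length of the word, so only the word of length 0 can be fixed.\<close>

lemma shift_word_eq_iff:
  assumes "n \<noteq> 0"
  shows "shift_word n w = w \<longleftrightarrow> w = {#}"
proof
  have "sum_mset (image_mset snd (shift_word n w)) = sum_mset (image_mset snd w) + n * int (size w)"
    by (induction w) (auto simp: shift_word_def algebra_simps)
  moreover assume "shift_word n w = w"
  ultimately show "w = {#}" using assms by simp
qed (simp add: shift_word_def)

lemma size_shift_word [simp]: "size (shift_word n w) = size w"
  by (simp add: shift_word_def)

section \<open>Development of words\<close>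

definition develop_letter :: "('a, 'b) pre_digraph \<Rightarrow> 'a \<times> int \<Rightarrow> ('a \<times> int) multiset" where
  "develop_letter G p =
     (if out_arcs G (fst p) = {} then {#p#}
      else image_mset (\<lambda>e. (head G e, snd p + 1)) (mset_set (out_arcs G (fst p))))"

definition develop :: "('a, 'b) pre_digraph \<Rightarrow> ('a \<times> int) multiset \<Rightarrow> ('a \<times> int) multiset" where
  "develop G w = (\<Sum>p\<in>#w. develop_letter G p)"

lemma develop_letter_word [simp]: "develop G {#p#} = develop_letter G p"
  by (simp add: develop_def)

lemma develop_empty [simp]: "develop G {#} = {#}"
  by (simp add: develop_def)

lemma develop_add: "develop G (w + u) = develop G w + develop G u"
  by (simp add: develop_def)

lemma develop_add_mset: "develop G (add_mset p w) = develop_letter G p + develop G w"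
  by (simp add: develop_def)

lemma develop_funpow_add: "(develop G ^^ n) (w + u) = (develop G ^^ n) w + (develop G ^^ n) u"
  by (induction n) (simp_all add: develop_add)

lemma develop_shift_word: "develop G (shift_word n w) = shift_word n (develop G w)"
proof (induction w)
  case empty
  show ?case by (simp add: develop_def shift_word_def)
next
  case (add p w)
  have "develop_letter G (case p of (v, i) \<Rightarrow> (v, i + n)) = shift_word n (develop_letter G p)"
    by (cases p) (simp add: develop_letter_def shift_word_def image_mset.compositionality o_def
        algebra_simps)
  with add show ?case
    by (simp add: develop_def shift_word_def)
qed

lemma develop_funpow_shift_word:
  "(develop G ^^ k) (shift_word n w) = shift_word n ((develop G ^^ k) w)"
  by (induction k) (simp_all add: develop_shift_word)

lemma develop_sinks: "s \<in> words_over (sinks G) \<Longrightarrow> develop G s = s"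
  by (induction rule: words_over_induct)
     (simp_all add: develop_add_mset develop_letter_def sinks_def)

lemma develop_funpow_sinks: "s \<in> words_over (sinks G) \<Longrightarrow> (develop G ^^ n) s = s"
  by (induction n) (simp_all add: develop_sinks)

lemma develop_funpow_mono:
  assumes "(develop G ^^ n) w \<in> words_over (sinks G)" "n \<le> m"
  shows "(develop G ^^ m) w = (develop G ^^ n) w"
proof -
  have "(develop G ^^ m) w = (develop G ^^ (m - n)) ((develop G ^^ n) w)"
    using assms(2) by (simp flip: funpow_add[THEN fun_cong, unfolded o_def])
  with assms(1) show ?thesis by (simp add: develop_funpow_sinks)
qed

text \<open>Words in sinks are fixed by \<open>develop\<close>, so at most one \<open>s\<close>
  qualifies: this is a partial normal form. It is a relation because a vertex of a finite graph from
  which a cycle can be reached never develops to sinks.\<close>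

definition develops_to ::
    "('a, 'b) pre_digraph \<Rightarrow> ('a \<times> int) multiset \<Rightarrow> ('a \<times> int) multiset \<Rightarrow> bool" where
  "develops_to G w s \<longleftrightarrow> s \<in> words_over (sinks G) \<and> (\<exists>n. (develop G ^^ n) w = s)"

lemma develops_to_sinks [simp]:
  "s \<in> words_over (sinks G) \<Longrightarrow> develops_to G s t \<longleftrightarrow> t = s"
  by (auto simp: develops_to_def develop_funpow_sinks)

text \<open>The summands may need different numbers of steps; the faster one waits, since a word in
  sinks no longer changes. The splitting of \<open>s\<close> later yields closure of ideals under
  summands and the description of the order.\<close>

lemma develops_to_add:
  "develops_to G (w + u) s \<longleftrightarrow> (\<exists>s1 s2. s = s1 + s2 \<and> develops_to G w s1 \<and> develops_to G u s2)"
proof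
  assume "develops_to G (w + u) s"
  then show "\<exists>s1 s2. s = s1 + s2 \<and> develops_to G w s1 \<and> develops_to G u s2"
    unfolding develops_to_def develop_funpow_add by (metis add_words_over)
next
  assume "\<exists>s1 s2. s = s1 + s2 \<and> develops_to G w s1 \<and> develops_to G u s2"
  then obtain n m where s: "s = (develop G ^^ n) w + (develop G ^^ m) u"
    and "(develop G ^^ n) w \<in> words_over (sinks G)" "(develop G ^^ m) u \<in> words_over (sinks G)"
    by (auto simp: develops_to_def)
  then have "(develop G ^^ max n m) (w + u) = s" "s \<in> words_over (sinks G)"
    using develop_funpow_mono[of n G w "max n m"] develop_funpow_mono[of m G u "max n m"]
    by (simp_all add: develop_funpow_add)
  then show "develops_to G (w + u) s"
    by (auto simp: develops_to_def)
qed

lemma develops_to_develop: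
  "develops_to G (develop G w) s \<longleftrightarrow> develops_to G w s"
proof
  assume "develops_to G (develop G w) s"
  then show "develops_to G w s"
    unfolding develops_to_def by (metis comp_apply funpow_Suc_right)
next
  assume "develops_to G w s"
  then obtain n where s: "s \<in> words_over (sinks G)" and n: "(develop G ^^ n) w = s"
    by (auto simp: develops_to_def)
  \<comment> \<open>One further step leaves a word in sinks unchanged, which also covers
    \<open>n = 0\<close>.\<close>
  then have "(develop G ^^ n) (develop G w) = s"
    by (simp add: develop_sinks flip: funpow_swap1)
  with s show "develops_to G (develop G w) s"
    by (auto simp: develops_to_def)
qed

lemma develops_to_shift_word:
  assumes "develops_to G w s"
  shows "develops_to G (shift_word n w) (shift_word n s)"
  using assms by (auto simp: develops_to_def develop_funpow_shift_word)

text \<open>A defining relation is one application of \<open>develop\<close> to a single letter, and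
  sums are handled by \<open>develops_to_add\<close>. This invariant is what tells classes
  apart.\<close>

lemma talented_eq_develops_to:
  "talented_eq G w w' \<Longrightarrow> develops_to G w s \<longleftrightarrow> develops_to G w' s"
proof (induction arbitrary: s rule: talented_eq.induct)
  case (step v i)
  then show ?case
    using develops_to_develop[of G "{#(v, i)#}" s] by (simp add: develop_letter_def)
qed (auto simp: develops_to_add)

section \<open>Ideals spanned by vertices, and facts on submonoids\<close>

text \<open>For \<open>V\<close> a set of sinks this is already an order ideal; for other
  \<open>V\<close> it need not be closed under summands.\<close>

definition ideal_over :: "('a, 'b) pre_digraph \<Rightarrow> 'a set \<Rightarrow> ('a \<times> int) multiset set set" where
  "ideal_over G V = (\<lambda>w. talented_rel G `` {w}) ` words_over V"

lemma finprod_submonoid_closed: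
  assumes "comm_monoid M" "submonoid H M" "\<And>i. i \<in> F \<Longrightarrow> x i \<in> H"
  shows "finprod M x F \<in> H"
proof -
  interpret comm_monoid M by fact
  interpret H: submonoid H M by fact
  show ?thesis
    using assms(3)
  \<comment> \<open>Over an infinite \<open>F\<close> the product is the unit by convention, and the
    unit lies in \<open>H\<close>.\<close>
  proof (induction F rule: infinite_finite_induct)
    case (insert a F)
    then have "x \<in> F \<rightarrow> carrier M" "x a \<in> carrier M"
      using H.subset by auto
    with insert show ?case by simp
  qed (simp_all add: H.one_closed)
qed

lemma Z_order_ideal_nonzero_element:
  assumes "Z_order_ideal M act I" "I \<noteq> {\<one>\<^bsub>M\<^esub>}"
  obtains x where "x \<in> I" "x \<noteq> \<one>\<^bsub>M\<^esub>"
  using assms submonoid.one_closed unfolding Z_order_ideal_def by blast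

section \<open>Classes of words in sinks\<close>

context fin_digraph
begin

abbreviation word_class ("\<lbrakk>_\<rbrakk>") where "word_class w \<equiv> talented_rel G `` {w}"

lemma words_eq: "words G = words_over (verts G)"
  by (simp add: words_def words_over_def)

lemma sinks_words: "V \<subseteq> sinks G \<Longrightarrow> w \<in> words_over V \<Longrightarrow> w \<in> words G"
  by (auto simp: words_def words_over_def sinks_def)

lemma word_class_eq_iff:
  "w \<in> words G \<Longrightarrow> u \<in> words G \<Longrightarrow> \<lbrakk>w\<rbrakk> = \<lbrakk>u\<rbrakk> \<longleftrightarrow> talented_eq G w u"
  using eq_equiv_class_iff[OF equiv_talented_rel] by (simp add: talented_rel_def)

lemma talented_eq_develop: "w \<in> words G \<Longrightarrow> talented_eq G w (develop G w)"
  unfolding words_eq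
proof (induction rule: words_over_induct)
  case empty
  show ?case by (simp add: develop_def empty_words talented_eq.refl)
next
  case (add v i w)
  have "talented_eq G {#(v, i)#} (develop_letter G (v, i))"
    using add.hyps talented_eq.step[of v G i]
    by (auto simp: develop_letter_def words_eq intro: talented_eq.refl)
  from talented_eq.add[OF this add.IH] show ?case
    by (simp add: develop_add_mset)
qed

lemma talented_eq_develop_funpow: "w \<in> words G \<Longrightarrow> talented_eq G w ((develop G ^^ n) w)"
  by (induction n)
     (auto intro: talented_eq.refl talented_eq.trans talented_eq_develop dest: talented_eq_words)

lemma talented_eq_if_develops_to: "w \<in> words G \<Longrightarrow> develops_to G w s \<Longrightarrow> talented_eq G w s"
  using talented_eq_develop_funpow by (auto simp: develops_to_def)

text \<open>Left to right is the invariance, as \<open>s\<close> develops to itself; right to left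
  holds because developing never leaves the class.\<close>

lemma develops_to_class_iff:
  assumes "w \<in> words G" "s \<in> words_over (sinks G)"
  shows "\<lbrakk>w\<rbrakk> = \<lbrakk>s\<rbrakk> \<longleftrightarrow> develops_to G w s"
proof -
  have "s \<in> words G" using sinks_words assms by blast
  with assms show ?thesis
    using talented_eq_develops_to[of G w s s] talented_eq_if_develops_to
    by (auto simp: word_class_eq_iff)
qed

text \<open>Each of the two words is its own development. This is the freeness of the submonoid
  spanned by the sinks.\<close>

lemma sinks_class_eq_iff:
  "s \<in> words_over (sinks G) \<Longrightarrow> t \<in> words_over (sinks G) \<Longrightarrow> \<lbrakk>s\<rbrakk> = \<lbrakk>t\<rbrakk> \<longleftrightarrow> s = t"
  using develops_to_class_iff[of s t] sinks_words[of "sinks G"] by auto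

lemma sinks_class_eq_one_iff:
  "s \<in> words_over (sinks G) \<Longrightarrow> \<lbrakk>s\<rbrakk> = \<one>\<^bsub>talented_monoid G\<^esub> \<longleftrightarrow> s = {#}"
  by (simp add: one_talented_monoid sinks_class_eq_iff)

text \<open>If \<open>t\<close> is congruent to \<open>s + u\<close>, then \<open>s + u\<close>
  develops to \<open>t\<close>, and the summand \<open>s\<close> survives unchanged.\<close>

lemma alg_le_sinks:
  assumes s: "s \<in> words_over (sinks G)" and t: "t \<in> words_over (sinks G)"
    and le: "alg_le (talented_monoid G) \<lbrakk>s\<rbrakk> \<lbrakk>t\<rbrakk>"
  shows "s \<subseteq># t"
proof -
  have sw: "s \<in> words G" using s sinks_words by blast
  obtain u where u: "u \<in> words G" "\<lbrakk>t\<rbrakk> = \<lbrakk>s + u\<rbrakk>"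
    using le sw by (auto simp: alg_le_def talented_mult_class elim!: carrier_talented_monoid_cases)
  then have "develops_to G (s + u) t"
    using develops_to_class_iff[of "s + u" t] t sw words_add by metis
  then show ?thesis
    using s by (auto simp: develops_to_add)
qed

section \<open>The order ideals spanned by sets of sinks\<close>

lemma ideal_over_cases:
  assumes "x \<in> ideal_over G V"
  obtains w where "w \<in> words_over V" "x = \<lbrakk>w\<rbrakk>"
  using assms by (auto simp: ideal_over_def)

lemma class_in_ideal_over: "w \<in> words_over V \<Longrightarrow> \<lbrakk>w\<rbrakk> \<in> ideal_over G V"
  by (simp add: ideal_over_def)

text \<open>The point is closure under summands: if \<open>p + q\<close> is congruent to a word
  \<open>s\<close> over \<open>V\<close>, then \<open>s\<close> is the sum of the developments of
  \<open>p\<close> and \<open>q\<close>, so these are words over \<open>V\<close> too.\<close>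

lemma ideal_over_Z_order_ideal:
  assumes V: "V \<subseteq> sinks G"
  shows "Z_order_ideal (talented_monoid G) (shift G) (ideal_over G V)"
  unfolding Z_order_ideal_def
proof (intro conjI allI ballI impI)
  note w = sinks_words[OF V]
  show "submonoid (ideal_over G V) (talented_monoid G)"
    by (rule submonoid.intro)
       (auto elim!: ideal_over_cases simp: w class_in_carrier talented_mult_class
          one_talented_monoid intro!: class_in_ideal_over)
  show "shift G n x \<in> ideal_over G V" if "x \<in> ideal_over G V" for n x
    using that by (auto elim!: ideal_over_cases simp: w shift_class intro!: class_in_ideal_over)
  fix a b
  assume a: "a \<in> carrier (talented_monoid G)" and b: "b \<in> carrier (talented_monoid G)"
    and ab: "a \<otimes>\<^bsub>talented_monoid G\<^esub> b \<in> ideal_over G V"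
  obtain p q where p: "p \<in> words G" "a = \<lbrakk>p\<rbrakk>" and q: "q \<in> words G" "b = \<lbrakk>q\<rbrakk>"
    using a b by (auto elim!: carrier_talented_monoid_cases)
  obtain s where s: "s \<in> words_over V" "\<lbrakk>p + q\<rbrakk> = \<lbrakk>s\<rbrakk>"
    using ab p q by (auto simp: talented_mult_class elim!: ideal_over_cases)
  then have "develops_to G (p + q) s"
    using develops_to_class_iff[of "p + q" s] p q words_add words_over_mono[OF V] by blast
  then obtain s1 s2 where d: "s = s1 + s2" "develops_to G p s1" "develops_to G q s2"
    by (auto simp: develops_to_add)
  then have "\<lbrakk>p\<rbrakk> = \<lbrakk>s1\<rbrakk>" "\<lbrakk>q\<rbrakk> = \<lbrakk>s2\<rbrakk>"
    using develops_to_class_iff p q by (auto simp: develops_to_def)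
  with s d p q show "a \<in> ideal_over G V" "b \<in> ideal_over G V"
    by (auto intro: class_in_ideal_over)
qed

lemma ideal_over_non_comparable:
  assumes V: "V \<subseteq> sinks G"
  shows "non_comparable (talented_monoid G) (shift G) (ideal_over G V)"
  unfolding non_comparable_def
proof (intro ballI impI allI)
  fix x and n :: int
  assume x: "x \<in> ideal_over G V" "x \<noteq> \<one>\<^bsub>talented_monoid G\<^esub>" and n: "n \<noteq> 0"
  obtain w where w: "w \<in> words_over (sinks G)" "x = \<lbrakk>w\<rbrakk>"
    using x(1) words_over_mono[OF V] by (auto elim: ideal_over_cases)
  have ne: "shift_word n w \<noteq> w"
    using x(2) w n by (simp add: shift_word_eq_iff one_talented_monoid) blast
  \<comment> \<open>The two words have equal length, so an inclusion either way would be an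
    equality.\<close>
  have "\<not> shift_word n w \<subseteq># w" "\<not> w \<subseteq># shift_word n w"
    using ne by (metis size_shift_word mset_subset_size nat_less_le subset_mset.le_less)+
  with w show "incomparable (talented_monoid G) (shift G n x) x"
    using alg_le_sinks sinks_words[of "sinks G"] by (auto simp: incomparable_def shift_class)
qed

section \<open>Letters in order ideals, and minimality\<close>

lemma Z_order_ideal_subset_carrier:
  "Z_order_ideal (talented_monoid G) (shift G) J \<Longrightarrow> J \<subseteq> carrier (talented_monoid G)"
  by (simp add: Z_order_ideal_def submonoid.subset)

lemma Z_order_ideal_add_iff:
  assumes "Z_order_ideal (talented_monoid G) (shift G) J" "w \<in> words G" "u \<in> words G"
  shows "\<lbrakk>w + u\<rbrakk> \<in> J \<longleftrightarrow> \<lbrakk>w\<rbrakk> \<in> J \<and> \<lbrakk>u\<rbrakk> \<in> J"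
proof -
  have "\<lbrakk>w + u\<rbrakk> = \<lbrakk>w\<rbrakk> \<otimes>\<^bsub>talented_monoid G\<^esub> \<lbrakk>u\<rbrakk>"
    using assms by (simp add: talented_mult_class)
  with assms show ?thesis
    using class_in_carrier submonoid.m_closed unfolding Z_order_ideal_def by metis
qed

text \<open>A letter of \<open>w\<close> is a summand and hence lies in \<open>J\<close>; the shift
  moves it to any index. Membership of a letter thus depends on its vertex alone.\<close>

lemma Z_order_ideal_letter:
  assumes J: "Z_order_ideal (talented_monoid G) (shift G) J"
    and w: "w \<in> words G" "\<lbrakk>w\<rbrakk> \<in> J" and v: "(v, i) \<in># w"
  shows "\<lbrakk>{#(v, j)#}\<rbrakk> \<in> J"
proof -
  obtain u where u: "w = {#(v, i)#} + u"
    using multi_member_split[OF v] by auto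
  then have vG: "{#(v, i)#} \<in> words G" "u \<in> words G"
    using w(1) by (auto simp: words_def)
  then have "\<lbrakk>{#(v, i)#}\<rbrakk> \<in> J"
    using Z_order_ideal_add_iff[OF J vG] w u by simp
  then have "shift G (j - i) \<lbrakk>{#(v, i)#}\<rbrakk> \<in> J"
    using J by (simp add: Z_order_ideal_def)
  with vG show ?thesis
    by (simp add: shift_class) (simp add: shift_word_def)
qed

lemma ideal_over_subset:
  assumes J: "Z_order_ideal (talented_monoid G) (shift G) J" and V: "V \<subseteq> sinks G"
    and v: "\<And>v i. v \<in> V \<Longrightarrow> \<lbrakk>{#(v, i)#}\<rbrakk> \<in> J"
  shows "ideal_over G V \<subseteq> J"
proof
  fix x assume "x \<in> ideal_over G V"
  then obtain w where w: "w \<in> words_over V" and x: "x = \<lbrakk>w\<rbrakk>"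
    by (rule ideal_over_cases)
  from w have "\<lbrakk>w\<rbrakk> \<in> J"
  proof (induction rule: words_over_induct)
    case empty
    show ?case
      using J submonoid.one_closed unfolding Z_order_ideal_def by (metis one_talented_monoid)
  next
    case (add u i w)
    then show ?case
      using Z_order_ideal_add_iff[OF J, of "{#(u, i)#}" w] v[of u i] sinks_words[OF V]
      by (simp add: words_over_def)
  qed
  with x show "x \<in> J" by simp
qed

text \<open>A nonzero element of a smaller ideal is the class of a nonempty word in \<open>v\<close>
  alone, so that ideal contains some \<open>v(i)\<close>, hence all of them, and these generate
  \<open>ideal_over G {v}\<close>.\<close>

lemma ideal_over_singleton_minimal:
  assumes v: "v \<in> sinks G"
  shows "minimal_Z_order_ideal (talented_monoid G) (shift G) (ideal_over G {v})"
  unfolding minimal_Z_order_ideal_def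
proof (intro conjI allI impI)
  show "Z_order_ideal (talented_monoid G) (shift G) (ideal_over G {v})"
    using v by (intro ideal_over_Z_order_ideal) simp
  have "\<lbrakk>{#(v, 0)#}\<rbrakk> \<in> ideal_over G {v}"
    by (simp add: class_in_ideal_over)
  moreover have "\<lbrakk>{#(v, 0)#}\<rbrakk> \<noteq> \<one>\<^bsub>talented_monoid G\<^esub>"
    using v by (simp add: sinks_class_eq_one_iff)
  ultimately show "ideal_over G {v} \<noteq> {\<one>\<^bsub>talented_monoid G\<^esub>}" by blast
  fix J
  assume "Z_order_ideal (talented_monoid G) (shift G) J \<and> J \<noteq> {\<one>\<^bsub>talented_monoid G\<^esub>}
    \<and> J \<subseteq> ideal_over G {v}"
  then have J: "Z_order_ideal (talented_monoid G) (shift G) J"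
    and J1: "J \<noteq> {\<one>\<^bsub>talented_monoid G\<^esub>}" and sub: "J \<subseteq> ideal_over G {v}"
    by auto
  obtain x where x: "x \<in> J" "x \<noteq> \<one>\<^bsub>talented_monoid G\<^esub>"
    using Z_order_ideal_nonzero_element[OF J J1] .
  then obtain w where w: "w \<in> words_over {v}" "x = \<lbrakk>w\<rbrakk>"
    using sub by (auto elim: ideal_over_cases)
  have "w \<noteq> {#}" using w x by (auto simp: one_talented_monoid)
  then obtain i where "(v, i) \<in># w"
    using w(1) by (fastforce simp: words_over_def)
  then have "\<lbrakk>{#(v, j)#}\<rbrakk> \<in> J" for j
    using Z_order_ideal_letter[OF J] x w sinks_words[of "{v}"] v by blast
  then have "ideal_over G {v} \<subseteq> J"
    using v by (intro ideal_over_subset[OF J]) auto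
  with sub show "J = ideal_over G {v}" by simp
qed

section \<open>Edges, cycles and non-comparable ideals\<close>

text \<open>One edge is split off the defining relation and \<open>u\<close> collects the others.
  The explicit remainder serves both closure under summands and the order.\<close>

lemma arc_class:
  assumes e: "e \<in> out_arcs G v"
  obtains u where "u \<in> words G" "\<lbrakk>{#(v, i)#}\<rbrakk> = \<lbrakk>{#(head G e, i + 1)#} + u\<rbrakk>"
proof -
  let ?u = "image_mset (\<lambda>e. (head G e, i + 1)) (mset_set (out_arcs G v - {e}))"
  have v: "v \<in> verts G" and fin: "finite (out_arcs G v)"
    using e by auto
  have "talented_eq G {#(v, i)#}
      (image_mset (\<lambda>e. (head G e, i + 1)) (mset_set (out_arcs G v)))"
    using v e by (intro talented_eq.step) auto
  also have "image_mset (\<lambda>e. (head G e, i + 1)) (mset_set (out_arcs G v))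
      = {#(head G e, i + 1)#} + ?u"
    using e fin by (simp add: mset_set.remove)
  finally have eq: "talented_eq G {#(v, i)#} ({#(head G e, i + 1)#} + ?u)" .
  show thesis
  proof (rule that)
    show "?u \<in> words G"
      using talented_eq_words[OF eq] by (simp add: words_def)
    show "\<lbrakk>{#(v, i)#}\<rbrakk> = \<lbrakk>{#(head G e, i + 1)#} + ?u\<rbrakk>"
      using talented_eq_words[OF eq] eq word_class_eq_iff by blast
  qed
qed

lemma alg_le_refl:
  assumes "x \<in> carrier (talented_monoid G)"
  shows "alg_le (talented_monoid G) x x"
proof -
  interpret comm_monoid "talented_monoid G" by (rule comm_monoid_talented_monoid)
  from assms show ?thesis
    unfolding alg_le_def by (metis one_closed r_one)
qed

lemma alg_le_trans:
  assumes "x \<in> carrier (talented_monoid G)"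
    and "alg_le (talented_monoid G) x y" "alg_le (talented_monoid G) y z"
  shows "alg_le (talented_monoid G) x z"
proof -
  interpret comm_monoid "talented_monoid G" by (rule comm_monoid_talented_monoid)
  from assms show ?thesis
    unfolding alg_le_def by (metis m_assoc m_closed)
qed

lemma develops_to_words_if_letters:
  assumes "w \<in> words_over V" and "\<And>v i. v \<in> V \<Longrightarrow> \<exists>s. develops_to G {#(v, i)#} s"
  shows "\<exists>s. develops_to G w s"
  using assms(1)
proof (induction rule: words_over_induct)
  case empty
  have "develops_to G {#} {#}" by simp
  then show ?case ..
next
  case (add v i w)
  then show ?case
    using assms(2)[of v i] develops_to_add[of G "{#(v, i)#}" w] by auto
qed

lemma non_comparable_letter_develops:
  assumes J: "Z_order_ideal (talented_monoid G) (shift G) J"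
    and nc: "non_comparable (talented_monoid G) (shift G) J"
    and v: "v \<in> verts G" "\<lbrakk>{#(v, i)#}\<rbrakk> \<in> J"
  shows "\<exists>s. develops_to G {#(v, i)#} s"
proof (rule ccontr)
  \<comment> \<open>\<open>D\<close> collects the vertices in \<open>J\<close> that do not develop
    to sinks. Both conditions are invariant under the shift, so \<open>DI\<close> asks for one index
    only.\<close>
  define D where
    "D = {u \<in> verts G. (\<forall>j. \<lbrakk>{#(u, j)#}\<rbrakk> \<in> J) \<and> (\<forall>j s. \<not> develops_to G {#(u, j)#} s)}"
  have DI: "u \<in> D"
    if "u \<in> verts G" "\<lbrakk>{#(u, j)#}\<rbrakk> \<in> J" "\<nexists>s. develops_to G {#(u, j)#} s" for u j
  proof -
    have "\<lbrakk>{#(u, k)#}\<rbrakk> \<in> J" for k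
      using Z_order_ideal_letter[OF J, of "{#(u, j)#}" u j k] that by (simp add: words_eq)
    \<comment> \<open>Shifting a development of \<open>u(k)\<close> by \<open>j - k\<close> would
      give one of \<open>u(j)\<close>.\<close>
    moreover have "\<not> develops_to G {#(u, k)#} s" for k s
      using that(3) develops_to_shift_word[of G "{#(u, k)#}" s "j - k"]
      by (auto simp: shift_word_def)
    ultimately show ?thesis using that(1) by (simp add: D_def)
  qed
  assume "\<nexists>s. develops_to G {#(v, i)#} s"
  with v have vD: "v \<in> D" by (blast intro: DI)
  \<comment> \<open>If every successor of \<open>u\<close> developed to sinks, so would the word
    \<open>develop G {#(u, 0)#}\<close>, and with it \<open>u\<close>.\<close>
  have "\<exists>e\<in>out_arcs G u. head G e \<in> D" if u: "u \<in> D" for u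
  proof (rule ccontr)
    assume no: "\<not> (\<exists>e\<in>out_arcs G u. head G e \<in> D)"
    have "u \<notin> sinks G"
      using u by (auto simp: D_def)
    then have dev: "develop G {#(u, 0)#}
        = image_mset (\<lambda>e. (head G e, 1)) (mset_set (out_arcs G u))"
      using u by (simp add: develop_letter_def sinks_def D_def)
    have letter: "\<exists>s. develops_to G {#(x, j)#} s" if "x \<in> head G ` out_arcs G u" for x j
    proof -
      obtain e where e: "e \<in> out_arcs G u" "x = head G e"
        using \<open>x \<in> head G ` out_arcs G u\<close> by blast
      \<comment> \<open>The index \<open>j - 1\<close> makes the head of \<open>e\<close> appear at
        index \<open>j\<close>.\<close>
      obtain r where r: "r \<in> words G" "\<lbrakk>{#(u, j - 1)#}\<rbrakk> = \<lbrakk>{#(x, j)#} + r\<rbrakk>"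
        using arc_class[OF e(1), of "j - 1"] e(2) by auto
      have x: "x \<in> verts G" using e by auto
      have "\<lbrakk>{#(u, j - 1)#}\<rbrakk> \<in> J" using u by (simp add: D_def)
      then have "\<lbrakk>{#(x, j)#}\<rbrakk> \<in> J"
        using Z_order_ideal_add_iff[OF J _ r(1), of "{#(x, j)#}"] r(2) x
        by (simp add: words_eq)
      with x no e show ?thesis using DI by blast
    qed
    have "develop G {#(u, 0)#} \<in> words_over (head G ` out_arcs G u)"
      unfolding dev words_over_def
      by (cases "finite (out_arcs G u)") (auto simp del: in_out_arcs_conv)
    then have "\<exists>s. develops_to G (develop G {#(u, 0)#}) s"
      by (rule develops_to_words_if_letters) (rule letter)
    then show False
      using u by (simp add: develops_to_develop D_def del: develop_letter_word)
  qed
  then obtain next_arc where next_arc: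
    "\<And>u. u \<in> D \<Longrightarrow> next_arc u \<in> out_arcs G u \<and> head G (next_arc u) \<in> D"
    by metis
  define f where "f u = head G (next_arc u)" for u
  have fD: "(f ^^ k) u \<in> D" if "u \<in> D" for k u
    using that next_arc by (induction k) (auto simp: f_def)
  have carrier: "\<lbrakk>{#(u, j)#}\<rbrakk> \<in> carrier (talented_monoid G)" if "u \<in> D" for u j
    using that by (intro class_in_carrier) (simp add: words_eq D_def)
  \<comment> \<open>Each edge along \<open>f\<close> goes down in the order and raises the index by
    one.\<close>
  have le: "alg_le (talented_monoid G) \<lbrakk>{#((f ^^ k) u, j + int k)#}\<rbrakk> \<lbrakk>{#(u, j)#}\<rbrakk>"
    if u: "u \<in> D" for k u j
  proof (induction k)
    case 0
    show ?case using alg_le_refl[OF carrier[OF u]] by simp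
  next
    case (Suc k)
    let ?x = "(f ^^ k) u"
    obtain r where r: "r \<in> words G"
      "\<lbrakk>{#(?x, j + int k)#}\<rbrakk> = \<lbrakk>{#(f ?x, j + int k + 1)#} + r\<rbrakk>"
      using arc_class[of "next_arc ?x" ?x "j + int k"] next_arc[OF fD[OF u]]
      unfolding f_def by metis
    have "{#(f ?x, j + int k + 1)#} \<in> words G"
      using fD[OF u, of "Suc k"] by (simp add: words_eq D_def)
    then have "alg_le (talented_monoid G) \<lbrakk>{#(f ?x, j + int k + 1)#}\<rbrakk> \<lbrakk>{#(?x, j + int k)#}\<rbrakk>"
      unfolding alg_le_def using r by (metis talented_mult_class class_in_carrier)
    moreover have "\<lbrakk>{#(f ?x, j + int k + 1)#}\<rbrakk> \<in> carrier (talented_monoid G)"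
      using carrier[OF fD[OF u, of "Suc k"]] by simp
    ultimately have "alg_le (talented_monoid G) \<lbrakk>{#(f ?x, j + int k + 1)#}\<rbrakk> \<lbrakk>{#(u, j)#}\<rbrakk>"
      using alg_le_trans Suc by blast
    then show ?case by (simp add: algebra_simps)
  qed
  have "finite D" by (simp add: D_def)
  \<comment> \<open>The walk from \<open>v\<close> stays in the finite set \<open>D\<close>, so it
    revisits a vertex, the \<open>u\<close> below, after \<open>b - a\<close> edges.\<close>
  then have "\<not> inj (\<lambda>k. (f ^^ k) v)"
    using fD[OF vD] finite_subset[of "range (\<lambda>k. (f ^^ k) v)" D] finite_imageD infinite_UNIV_nat
    by blast
  then obtain a b where ab: "a < b" "(f ^^ a) v = (f ^^ b) v"
    unfolding inj_def by (metis linorder_neqE_nat)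
  define u where "u = (f ^^ a) v"
  have u: "u \<in> D" unfolding u_def by (rule fD[OF vD])
  have "(f ^^ (b - a)) u = (f ^^ (b - a + a)) v"
    by (simp only: u_def funpow_add comp_apply)
  then have "(f ^^ (b - a)) u = u"
    using ab by (simp add: u_def)
  \<comment> \<open>Once around the closed walk, \<open>u(0)\<close> dominates its own shift by
    \<open>b - a\<close>, which is not 0.\<close>
  then have "alg_le (talented_monoid G) \<lbrakk>{#(u, int (b - a))#}\<rbrakk> \<lbrakk>{#(u, 0)#}\<rbrakk>"
    using le[OF u, of "b - a" 0] by simp
  moreover have "\<lbrakk>{#(u, int (b - a))#}\<rbrakk> = shift G (int (b - a)) \<lbrakk>{#(u, 0)#}\<rbrakk>"
    using u by (subst shift_class) (simp_all add: words_eq D_def shift_word_def)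
  moreover have "\<lbrakk>{#(u, 0)#}\<rbrakk> \<in> J" using u by (simp add: D_def)
  \<comment> \<open>If this class were zero, \<open>u(0)\<close> would develop to the empty word,
    contrary to \<open>u \<in> D\<close>.\<close>
  moreover have "\<lbrakk>{#(u, 0)#}\<rbrakk> \<noteq> \<one>\<^bsub>talented_monoid G\<^esub>"
    using u develops_to_class_iff[of "{#(u, 0)#}" "{#}"]
    by (simp add: one_talented_monoid D_def words_eq)
  ultimately show False
    using nc ab(1) by (auto simp: non_comparable_def incomparable_def)
qed

text \<open>All letters of a word representing \<open>x\<close> lie in \<open>J\<close> with all
  their shifts, so each develops to sinks, and so does the word.\<close>

lemma non_comparable_subset_sinks:
  assumes J: "Z_order_ideal (talented_monoid G) (shift G) J"
    and nc: "non_comparable (talented_monoid G) (shift G) J"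
  shows "J \<subseteq> ideal_over G (sinks G)"
proof
  fix x assume x: "x \<in> J"
  then obtain w where w: "w \<in> words G" "x = \<lbrakk>w\<rbrakk>"
    using Z_order_ideal_subset_carrier[OF J] by (blast elim: carrier_talented_monoid_cases)
  have "w \<in> words_over (fst ` set_mset w)"
    by (force simp: words_over_def)
  moreover have "\<exists>s. develops_to G {#(v, i)#} s" if "v \<in> fst ` set_mset w" for v i
  proof (rule non_comparable_letter_develops[OF J nc])
    show "v \<in> verts G" using that w by (auto simp: words_def)
    show "\<lbrakk>{#(v, i)#}\<rbrakk> \<in> J"
      using that Z_order_ideal_letter[OF J w(1)] x w(2) by force
  qed
  ultimately obtain s where "develops_to G w s"
    using develops_to_words_if_letters by blast
  then have "x = \<lbrakk>s\<rbrakk>" "s \<in> words_over (sinks G)"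
    using w develops_to_class_iff by (auto simp: develops_to_def)
  then show "x \<in> ideal_over G (sinks G)"
    by (simp add: class_in_ideal_over)
qed

section \<open>The correspondence and the sum of the minimal ideals\<close>

text \<open>By freeness, a word over \<open>{u}\<close> can represent \<open>v(0)\<close> only if it
  is the letter \<open>v(0)\<close> itself.\<close>

lemma inj_on_ideal_over_singleton: "inj_on (\<lambda>v. ideal_over G {v}) (sinks G)"
proof (rule inj_onI)
  fix v u assume v: "v \<in> sinks G" and u: "u \<in> sinks G" and eq: "ideal_over G {v} = ideal_over G {u}"
  have "\<lbrakk>{#(v, 0)#}\<rbrakk> \<in> ideal_over G {u}"
    using class_in_ideal_over[of "{#(v, 0)#}" "{v}"] eq by simp
  then obtain w where w: "w \<in> words_over {u}" "\<lbrakk>{#(v, 0)#}\<rbrakk> = \<lbrakk>w\<rbrakk>"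
    by (rule ideal_over_cases)
  moreover have "w \<in> words_over (sinks G)"
    using w(1) words_over_mono[of "{u}" "sinks G"] u by blast
  ultimately have "{#(v, 0)#} = w"
    using v by (simp add: sinks_class_eq_iff)
  with w(1) show "v = u" by auto
qed

text \<open>A nonzero element of a non-comparable \<open>J\<close> is the class of a nonempty word
  in sinks. Any vertex \<open>v\<close> in this word puts \<open>ideal_over G {v}\<close> inside
  \<open>J\<close>, and minimality makes the two equal.\<close>

lemma non_comparable_minimal_ideals_eq:
  "non_comparable_minimal_ideals (talented_monoid G) (shift G) = (\<lambda>v. ideal_over G {v}) ` sinks G"
proof (intro equalityI subsetI)
  fix J assume "J \<in> (\<lambda>v. ideal_over G {v}) ` sinks G"
  then show "J \<in> non_comparable_minimal_ideals (talented_monoid G) (shift G)"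
    using ideal_over_singleton_minimal ideal_over_non_comparable
    by (auto simp: non_comparable_minimal_ideals_def)
next
  fix J assume "J \<in> non_comparable_minimal_ideals (talented_monoid G) (shift G)"
  then have min: "minimal_Z_order_ideal (talented_monoid G) (shift G) J"
    and J: "Z_order_ideal (talented_monoid G) (shift G) J"
    and J1: "J \<noteq> {\<one>\<^bsub>talented_monoid G\<^esub>}"
    and nc: "non_comparable (talented_monoid G) (shift G) J"
    by (auto simp: non_comparable_minimal_ideals_def minimal_Z_order_ideal_def)
  obtain x where x: "x \<in> J" "x \<noteq> \<one>\<^bsub>talented_monoid G\<^esub>"
    using Z_order_ideal_nonzero_element[OF J J1] .
  then obtain w where w: "w \<in> words_over (sinks G)" "x = \<lbrakk>w\<rbrakk>"
    using non_comparable_subset_sinks[OF J nc] by (auto elim: ideal_over_cases)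
  have "w \<noteq> {#}" using w x by (auto simp: one_talented_monoid)
  then obtain v i where vi: "(v, i) \<in># w" "v \<in> sinks G"
    using w(1) by (fastforce simp: words_over_def)
  then have "\<lbrakk>{#(v, j)#}\<rbrakk> \<in> J" for j
    using Z_order_ideal_letter[OF J] x w sinks_words[of "sinks G"] by blast
  then have "ideal_over G {v} \<subseteq> J"
    using vi by (intro ideal_over_subset[OF J]) auto
  moreover have "Z_order_ideal (talented_monoid G) (shift G) (ideal_over G {v})"
    "ideal_over G {v} \<noteq> {\<one>\<^bsub>talented_monoid G\<^esub>}"
    using ideal_over_singleton_minimal[OF vi(2)] by (auto simp: minimal_Z_order_ideal_def)
  ultimately have "ideal_over G {v} = J"
    using min by (auto simp: minimal_Z_order_ideal_def)
  with vi show "J \<in> (\<lambda>v. ideal_over G {v}) ` sinks G" by blast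
qed

lemma ideal_over_subset_ideal_sum:
  "ideal_over G (sinks G) \<subseteq> ideal_sum (talented_monoid G) ((\<lambda>v. ideal_over G {v}) ` sinks G)"
proof
  interpret comm_monoid "talented_monoid G" by (rule comm_monoid_talented_monoid)
  let ?f = "\<lambda>v. ideal_over G {v}"
  fix x assume "x \<in> ideal_over G (sinks G)"
  then obtain w where w: "w \<in> words_over (sinks G)" and x: "x = \<lbrakk>w\<rbrakk>"
    by (rule ideal_over_cases)
  \<comment> \<open>The letters of \<open>w\<close> are grouped by vertex, giving one summand for
    each sink.\<close>
  define part where "part v = \<lbrakk>filter_mset (\<lambda>p. fst p = v) w\<rbrakk>" for v
  have wG: "filter_mset P w \<in> words G" for P
    using sinks_words[OF _ w] by (auto simp: words_def)
  then have part_carrier: "part v \<in> carrier (talented_monoid G)" for v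
    by (simp add: part_def class_in_carrier)
  have fin: "finite (sinks G)" by (simp add: sinks_def)
  \<comment> \<open>\<open>ideal_sum\<close> indexes its summands by ideals instead of vertices;
    injectivity recovers the sink from its ideal.\<close>
  have inv: "inv_into (sinks G) ?f (?f v) = v" if "v \<in> sinks G" for v
    using inj_on_ideal_over_singleton that by (rule inv_into_f_f)
  \<comment> \<open>Arbitrary finite \<open>A\<close> makes the induction possible; for
    \<open>A = sinks G\<close> the filter returns \<open>w\<close>.\<close>
  have "finprod (talented_monoid G) part A = \<lbrakk>filter_mset (\<lambda>p. fst p \<in> A) w\<rbrakk>"
    if "finite A" for A
    using that
  proof (induction A)
    case empty
    show ?case by (simp add: one_talented_monoid)
  next
    case (insert v A)
    have "filter_mset (\<lambda>p. fst p \<in> insert v A) w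
        = filter_mset (\<lambda>p. fst p = v) w + filter_mset (\<lambda>p. fst p \<in> A) w"
      using insert.hyps by (intro multiset_eqI) auto
    with insert show ?case
      by (simp add: part_carrier) (simp add: part_def wG talented_mult_class)
  qed
  moreover have "filter_mset (\<lambda>p. fst p \<in> sinks G) w = w"
    using w by (subst filter_mset_eq_conv) (auto simp: words_over_def)
  ultimately have "x = finprod (talented_monoid G) part (sinks G)"
    using fin x by simp
  also have "\<dots> = finprod (talented_monoid G) ((part \<circ> inv_into (sinks G) ?f) \<circ> ?f) (sinks G)"
    by (intro finprod_cong') (simp_all add: part_carrier inv)
  also have "\<dots> = finprod (talented_monoid G) (part \<circ> inv_into (sinks G) ?f) (?f ` sinks G)"
    using inj_on_ideal_over_singleton
    by (subst finprod_reindex) (simp_all add: part_carrier comp_def)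
  finally have xeq: "x = \<dots>" .
  have "(part \<circ> inv_into (sinks G) ?f) I \<in> I" if "I \<in> ?f ` sinks G" for I
  proof -
    obtain v where "v \<in> sinks G" "I = ?f v"
      using \<open>I \<in> ?f ` sinks G\<close> by blast
    then show ?thesis
      by (auto simp: part_def words_over_def inv intro!: class_in_ideal_over)
  qed
  with xeq fin show "x \<in> ideal_sum (talented_monoid G) (?f ` sinks G)"
    unfolding ideal_sum_def by blast
qed

lemma ideal_sum_eq_ideal_over:
  "ideal_sum (talented_monoid G) ((\<lambda>v. ideal_over G {v}) ` sinks G) = ideal_over G (sinks G)"
proof
  have "submonoid (ideal_over G (sinks G)) (talented_monoid G)"
    using ideal_over_Z_order_ideal by (simp add: Z_order_ideal_def)
  moreover have "ideal_over G {v} \<subseteq> ideal_over G (sinks G)" if "v \<in> sinks G" for v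
    unfolding ideal_over_def using that by (intro image_mono words_over_mono) simp
  ultimately have "finprod (talented_monoid G) x F \<in> ideal_over G (sinks G)"
    if "F \<subseteq> (\<lambda>v. ideal_over G {v}) ` sinks G" "\<forall>I\<in>F. x I \<in> I" for x F
    using that by (intro finprod_submonoid_closed[OF comm_monoid_talented_monoid]) blast+
  then show "ideal_sum (talented_monoid G) ((\<lambda>v. ideal_over G {v}) ` sinks G)
      \<subseteq> ideal_over G (sinks G)"
    unfolding ideal_sum_def by blast
qed (rule ideal_over_subset_ideal_sum)

end

theorem theorem3p11:
  fixes E :: "('a, 'b) pre_digraph"
  assumes "fin_digraph E"
  shows "(\<exists>f. bij_betw f (sinks E)
            (non_comparable_minimal_ideals (talented_monoid E) (shift E)))
       \<and> largest_non_comparable_ideal (talented_monoid E) (shift E)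
            (ideal_sum (talented_monoid E)
              (non_comparable_minimal_ideals (talented_monoid E) (shift E)))"
proof -
  interpret fin_digraph E by fact
  \<comment> \<open>The bijection sends a sink \<open>v\<close> to \<open>ideal_over E {v}\<close>,
    and the largest non-comparable ideal is \<open>ideal_over E (sinks E)\<close>.\<close>
  show ?thesis
    unfolding non_comparable_minimal_ideals_eq ideal_sum_eq_ideal_over
      largest_non_comparable_ideal_def
    using inj_on_ideal_over_singleton ideal_over_Z_order_ideal ideal_over_non_comparable
      non_comparable_subset_sinks
    by (blast intro: inj_on_imp_bij_betw)
qed

end
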